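(* For every real matrix $B\in\mathbb R^{d\times r}$, there exists $k^0\in\mathbb Z_{>0}^r$ such that, for every $k\in\mathbb Z_{>0}^r$ with $k\ge k^0$ coordinatewise, $$\dim\ker B^{(2k)}-\sigma(B^{(2k)})=\dim\ker B-\ell_{\mathbb Z}(B).$$ The same conclusion holds for all sufficiently large uniform even replications, i.e. with $B^{(2k)}$ where $k=(\kappa,\dots,\kappa)$ for all sufficiently large integers $\kappa$.
   Context: For $m\in\mathbb Z_{>0}^r$ and a matrix $B$ with $r$ columns, $B^{(m)}$ is the matrix obtained by repeating the $t$th column of $B$ exactly $m_t$ times, $t=1,\dots,r$. For a matrix $Y$ with $n$ columns, $\sigma(Y)=\dim\operatorname{span}(\ker Y\cap\{-1,1\}^n)$ (real span, $\operatorname{span}\varnothing=\{0\}$). Also $\ell_{\mathbb Z}(B)=\dim\operatorname{span}(\ker B\cap\mathbb Z^r)$, again with real span. *)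

theory Defs
  imports "Jordan_Normal_Form.Matrix_Kernel"
begin

text \<open>Intended for \<^term>\<open>m \<in> carrier_vec (dim_col B)\<close>: the copies of column \<open>0\<close> come first,
  then those of column \<open>1\<close>, and so on, giving \<open>\<Sum>t. m $ t\<close> columns in total.\<close>

definition replicate_cols :: "real mat \<Rightarrow> nat vec \<Rightarrow> real mat" where
  "replicate_cols B m =
     mat_of_cols (dim_row B) (concat (map (\<lambda>t. replicate (m $ t) (col B t)) [0..<dim_col B]))"

text \<open>Dimension of the real linear span of a set \<open>S \<subseteq> carrier_vec n\<close>.\<close>

definition span_dim :: "nat \<Rightarrow> real vec set \<Rightarrow> nat" where
  "span_dim n S = vectorspace.dim class_ring
     ((module_vec TYPE(real) n)
        \<lparr>carrier := LinearCombinations.module.span class_ring (module_vec TYPE(real) n) S\<rparr>)"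

definition sign_vecs :: "nat \<Rightarrow> real vec set" where
  "sign_vecs n = {v \<in> carrier_vec n. \<forall>i<n. v $ i \<in> {-1, 1}}"

definition int_vecs :: "nat \<Rightarrow> real vec set" where
  "int_vecs n = {v \<in> carrier_vec n. \<forall>i<n. v $ i \<in> \<int>}"

definition sigma :: "real mat \<Rightarrow> nat" where
  "sigma Y = span_dim (dim_col Y) (mat_kernel Y \<inter> sign_vecs (dim_col Y))"

definition ell_int :: "real mat \<Rightarrow> nat" where
  "ell_int B = span_dim (dim_col B) (mat_kernel B \<inter> int_vecs (dim_col B))"

end

theory Submission
  imports Defs
begin

text \<open>
  Let every column \<open>t\<close> be repeated \<open>2k\<^sub>t\<close> times, let \<open>N\<close> be the number of columns of the replicated
  matrix, and let \<open>A\<close> be the \<open>r \<times> N\<close> matrix that adds up the coordinates within each block of copies of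
  a column. Then the replicated matrix is \<open>B * A\<close>
  (\<open>replicate_cols_eq_mult\<close>), so its kernel is the preimage under \<open>A\<close> of the kernel of \<open>B\<close>.

  Let \<open>L\<close> be the real span of the integer points of the kernel of \<open>B\<close>. For large \<open>k\<close> the sign vectors in
  the kernel of \<open>B * A\<close> span exactly the preimage of \<open>L\<close> (\<open>span_sign_vecs_eq_vimage\<close>). They lie in
  it, since block sums of sign vectors are integers. Conversely, exchanging two opposite signs in a block
  shows that the span contains all differences of unit vectors within a block, hence the kernel of \<open>A\<close>
  (\<open>unit_vec_diff_in_subspace\<close>, \<open>summation_kernel_subset\<close>); and a block of \<open>2k\<^sub>t\<close> signs attains every even sum
  between \<open>-2k\<^sub>t\<close> and \<open>2k\<^sub>t\<close> (\<open>sign_vec_with_block_sums\<close>), so once \<open>k\<close>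
  dominates the absolute values of the entries of finitely many integer vectors spanning \<open>L\<close>, the
  image of the span under \<open>A\<close> is all of \<open>L\<close>.

  Since \<open>A\<close> is surjective, passing to preimages adds the dimension of the kernel of \<open>A\<close>
  (\<open>dim_vimage_mult_mat_vec\<close>), and this cancels in the difference
  (\<open>kernel_dim_minus_sigma\<close>). The same threshold can be used for all coordinates of \<open>k\<close>, which
  gives the uniform version.
\<close>

section \<open>Subspaces of coordinate space\<close>

context vec_space
begin

lemma submoduleI_vec:
  assumes "W \<subseteq> carrier_vec n" "0\<^sub>v n \<in> W"
    and "\<And>v w. v \<in> W \<Longrightarrow> w \<in> W \<Longrightarrow> v + w \<in> W"
    and "\<And>c v. v \<in> W \<Longrightarrow> c \<cdot>\<^sub>v v \<in> W"
  shows "submodule class_ring W V"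
  by (rule submodule.intro[OF vec_module])
    (use assms in \<open>auto simp: module_vec_simps\<close>)

lemma submoduleD_vec:
  assumes "submodule class_ring W V"
  shows "W \<subseteq> carrier_vec n" "0\<^sub>v n \<in> W"
    and "\<And>v w. v \<in> W \<Longrightarrow> w \<in> W \<Longrightarrow> v + w \<in> W"
    and "\<And>c v. v \<in> W \<Longrightarrow> c \<cdot>\<^sub>v v \<in> W"
  using submodule.subset[OF assms] submodule.zero_closed[OF assms]
    submodule.m_closed[OF assms] submodule.smult_closed[OF assms]
  by (auto simp: module_vec_simps)

lemma submodule_diff_vec:
  assumes "submodule class_ring W V" "v \<in> W" "w \<in> W"
  shows "v - w \<in> W"
proof -
  have "v \<in> carrier_vec n" "w \<in> carrier_vec n" using submoduleD_vec(1)[OF assms(1)] assms by auto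
  then have "v - w = v + (- 1) \<cdot>\<^sub>v w" by auto
  then show ?thesis using submoduleD_vec(3,4)[OF assms(1)] assms by metis
qed

text \<open>Linear combinations are written coordinatewise and indexed by an arbitrary set, so that
  coinciding vectors \<open>f j\<close> are counted once per index.\<close>

lemma submodule_sum_vec:
  assumes W: "submodule class_ring W V" and "finite A" "\<And>j. j \<in> A \<Longrightarrow> f j \<in> W"
  shows "vec n (\<lambda>i. \<Sum>j\<in>A. c j * f j $ i) \<in> W"
  using assms(2,3)
proof (induction A rule: finite_induct)
  case empty
  have "vec n (\<lambda>i. \<Sum>j\<in>{}. c j * f j $ i) = 0\<^sub>v n" by auto
  then show ?case using submoduleD_vec(2)[OF W] by simp
next
  case (insert a A)
  have fa: "f a \<in> carrier_vec n" using insert submoduleD_vec(1)[OF W] by auto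
  have "vec n (\<lambda>i. \<Sum>j\<in>insert a A. c j * f j $ i) = c a \<cdot>\<^sub>v f a + vec n (\<lambda>i. \<Sum>j\<in>A. c j * f j $ i)"
    using insert fa by (intro eq_vecI) auto
  then show ?case using submoduleD_vec(3,4)[OF W] insert by auto
qed

text \<open>A maximal linearly independent subset of \<open>S\<close> exists because the dimension bounds the size of
  such sets, and by maximality it spans \<open>S\<close>. It matters that the spanning vectors are taken from \<open>S\<close>
  itself: applied to the integer points of a kernel, this yields a spanning set that is both finite
  and integral.\<close>

lemma finite_spanning_subset:
  assumes S: "S \<subseteq> carrier_vec n"
  shows "\<exists>A\<subseteq>S. finite A \<and> span A = span S"
proof -
  define P where "P A \<longleftrightarrow> A \<subseteq> S \<and> lin_indpt A" for A
  have "P {}" unfolding P_def lin_dep_def by auto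
  moreover have "finite A \<and> card A \<le> n" if "P A" for A
    using li_le_dim[OF fin_dim, of A] that S unfolding P_def dim_is_n by auto
  ultimately obtain A where A: "finite A" "maximal A P"
    using maximal_exists[of P n "{}"] by blast
  then have AS: "A \<subseteq> S" and li: "lin_indpt A" and mx: "\<And>B. B \<supseteq> A \<Longrightarrow> P B \<Longrightarrow> B = A"
    unfolding maximal_def P_def by blast+
  have AC: "A \<subseteq> carrier_vec n" using AS S by auto
  have "v \<in> span A" if v: "v \<in> S" for v
  proof (cases "v \<in> A")
    case True
    then show ?thesis using in_own_span[of A] AC by auto
  next
    case False
    then have "\<not> P (A \<union> {v})" using mx[of "A \<union> {v}"] by auto
    then have "lin_dep (A \<union> {v})" using AS v unfolding P_def by auto
    then show ?thesis using lin_dep_iff_in_span[of A v] AC li v S False by auto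
  qed
  then have "span S \<subseteq> span A" using span_subsetI[OF AC, of S] by blast
  moreover have "span A \<subseteq> span S" using AS by (rule span_is_monotone)
  ultimately show ?thesis using A AS by blast
qed

lemma span_submodule:
  assumes "submodule class_ring W V"
  shows "span W = W"
  using span_is_subset[OF subset_refl assms] in_own_span[of W] submoduleD_vec(1)[OF assms] by auto

lemma fin_dim_submodule:
  assumes "submodule class_ring W V"
  shows "vectorspace.fin_dim class_ring (vs W)"
proof -
  have WC: "W \<subseteq> carrier_vec n" by (rule submoduleD_vec(1)[OF assms])
  obtain A where "A \<subseteq> W" "finite A" "span A = span W" using finite_spanning_subset[OF WC] by auto
  then show ?thesis using fin_dim_span[of A] WC span_submodule[OF assms] by auto
qed

end

text \<open>Rank-nullity for \<open>A\<close> restricted to the preimage \<open>U\<close> of \<open>W\<close>: the image is all of \<open>W\<close> by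
  surjectivity, and the kernel is the whole kernel of \<open>A\<close> because \<open>0 \<in> W\<close>. The correction term does
  not depend on \<open>W\<close>, so it cancels when two preimages are compared.\<close>

lemma dim_vimage_mult_mat_vec:
  fixes A :: "'a :: field mat"
  assumes A: "A \<in> carrier_mat r n"
    and surj: "\<And>w. w \<in> carrier_vec r \<Longrightarrow> \<exists>y\<in>carrier_vec n. A *\<^sub>v y = w"
    and W: "submodule class_ring W (module_vec TYPE('a) r)"
  defines "U \<equiv> {y \<in> carrier_vec n. A *\<^sub>v y \<in> W}"
  shows "vectorspace.dim class_ring (module_vec TYPE('a) n\<lparr>carrier := U\<rparr>)
       = vectorspace.dim class_ring (module_vec TYPE('a) r\<lparr>carrier := W\<rparr>) + kernel_dim A"
    and "submodule class_ring U (module_vec TYPE('a) n)"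
proof -
  interpret n: vec_space "TYPE('a)" n .
  interpret r: vec_space "TYPE('a)" r .
  note WD = r.submoduleD_vec[OF W]
  have "A *\<^sub>v 0\<^sub>v n = 0\<^sub>v r" using A by auto
  show U: "submodule class_ring U (module_vec TYPE('a) n)"
    by (rule n.submoduleI_vec)
      (use A WD \<open>A *\<^sub>v 0\<^sub>v n = 0\<^sub>v r\<close> in \<open>auto simp: U_def mult_add_distrib_mat_vec[OF A] mult_mat_vec[OF A]\<close>)
  let ?U = "module_vec TYPE('a) n\<lparr>carrier := U\<rparr>"
  let ?V = "module_vec TYPE('a) r"
  have vU: "vectorspace class_ring ?U"
    using n.subspace_is_vs U subspace.intro[OF vec_vs U] by blast
  have hom: "mod_hom class_ring ?U ?V (\<lambda>y. A *\<^sub>v y)"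
    unfolding mod_hom_def mod_hom_axioms_def LinearCombinations.module_hom_def
    using vU vec_vs[of r, where ?'a='a] A
    by (auto simp: vectorspace_def U_def module_vec_simps 
          mult_add_distrib_mat_vec[OF A] mult_mat_vec[OF A])
  have lin: "linear_map class_ring ?U ?V (\<lambda>y. A *\<^sub>v y)"
    by (rule linear_map.intro[OF vU vec_vs hom])
  have "(\<lambda>y. A *\<^sub>v y) ` U = W"
  proof
    show "W \<subseteq> (\<lambda>y. A *\<^sub>v y) ` U"
    proof
      fix w assume w: "w \<in> W"
      then obtain y where "y \<in> carrier_vec n" "A *\<^sub>v y = w" using surj WD(1) by blast
      then show "w \<in> (\<lambda>y. A *\<^sub>v y) ` U" using w by (auto simp: U_def)
    qed
  qed (auto simp: U_def)
  moreover have "mod_hom.im ?U (\<lambda>y. A *\<^sub>v y) = (\<lambda>y. A *\<^sub>v y) ` carrier ?U"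
    by (rule mod_hom.im_def[OF hom])
  ultimately have im: "mod_hom.im ?U (\<lambda>y. A *\<^sub>v y) = W" by simp
  have "mod_hom.ker ?U ?V (\<lambda>y. A *\<^sub>v y) = {y. y \<in> carrier ?U \<and> A *\<^sub>v y = \<zero>\<^bsub>?V\<^esub>}"
    by (rule mod_hom.ker_def[OF hom])
  also have "\<dots> = {y. y \<in> U \<and> A *\<^sub>v y = 0\<^sub>v r}" by (simp add: module_vec_simps)
  also have "\<dots> = mat_kernel A" using WD(2) by (auto simp: U_def mat_kernel[OF A])
  finally have ker: "mod_hom.ker ?U ?V (\<lambda>y. A *\<^sub>v y) = mat_kernel A" .
  show "vectorspace.dim class_ring ?U
       = vectorspace.dim class_ring (module_vec TYPE('a) r\<lparr>carrier := W\<rparr>) + kernel_dim A"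
    using linear_map.rank_nullity[OF lin n.fin_dim_submodule[OF U]] A
    unfolding im ker kernel_dim_def by simp
qed

section \<open>Sign vectors with prescribed block sums\<close>

text \<open>The coordinates \<open>0, \<dots>, N - 1\<close> are partitioned into \<open>r\<close> blocks of even positive sizes, \<open>b j\<close> being
  the block of \<open>j\<close>. For a replicated matrix, a block collects the copies of one original column.\<close>

locale even_blocks =
  fixes N r :: nat and b k :: "nat \<Rightarrow> nat"
  assumes label_less: "j < N \<Longrightarrow> b j < r"
    and card_block: "t < r \<Longrightarrow> card {j. j < N \<and> b j = t} = 2 * k t"
    and size_pos: "t < r \<Longrightarrow> 0 < k t"
begin

abbreviation block :: "nat \<Rightarrow> nat set" where
  "block t \<equiv> {j. j < N \<and> b j = t}"

definition summation_mat :: "real mat" where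
  "summation_mat = mat r N (\<lambda>(t, j). if b j = t then 1 else 0)"

definition sign_vec :: "nat set \<Rightarrow> real vec" where
  "sign_vec P = vec N (\<lambda>j. if j \<in> P then 1 else - 1)"

lemma summation_mat_carrier [simp]: "summation_mat \<in> carrier_mat r N"
  by (simp add: summation_mat_def)

lemma dim_summation_mat [simp]: "dim_row summation_mat = r" "dim_col summation_mat = N"
  by (simp_all add: summation_mat_def)

lemma sign_vec_carrier [simp]: "sign_vec P \<in> carrier_vec N"
  by (simp add: sign_vec_def)

lemma sign_vec_in_sign_vecs: "sign_vec P \<in> sign_vecs N"
  by (simp add: sign_vec_def sign_vecs_def)

lemma block_sum:
  assumes "y \<in> carrier_vec N" "t < r"
  shows "(summation_mat *\<^sub>v y) $ t = (\<Sum>j\<in>block t. y $ j)"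
proof -
  have "(summation_mat *\<^sub>v y) $ t = (\<Sum>j\<in>{0..<N}. (if b j = t then 1 else 0) * y $ j)"
    using assms by (simp add: summation_mat_def scalar_prod_def)
  also have "\<dots> = (\<Sum>j\<in>{0..<N}. if b j = t then y $ j else 0)"
    by (intro sum.cong) auto
  also have "\<dots> = (\<Sum>j\<in>{0..<N} \<inter> {j. b j = t}. y $ j)"
    by (simp add: sum.inter_restrict)
  also have "{0..<N} \<inter> {j. b j = t} = block t" by auto
  finally show ?thesis .
qed

text \<open>With \<open>c\<close> plus signs among \<open>2 * k t\<close> entries, the sum is \<open>c - (2 * k t - c)\<close>.\<close>

lemma block_sum_sign_vec:
  assumes "t < r"
  shows "(summation_mat *\<^sub>v sign_vec P) $ t = 2 * (real (card (P \<inter> block t)) - real (k t))"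
proof -
  have fin: "finite (block t)" by simp
  have "(summation_mat *\<^sub>v sign_vec P) $ t = (\<Sum>j\<in>block t. if j \<in> P then 1 else - 1)"
    using assms by (subst block_sum) (auto simp: sign_vec_def intro!: sum.cong)
  also have "\<dots> = (\<Sum>j\<in>block t. 2 * (if j \<in> P then 1 else 0) - 1)"
    by (intro sum.cong) auto
  also have "\<dots> = 2 * real (card (block t \<inter> P)) - real (card (block t))"
    using fin by (simp add: sum_subtractf flip: sum_distrib_left sum.inter_restrict)
  finally show ?thesis by (simp add: card_block[OF assms] Int_commute)
qed

text \<open>Blocks are disjoint, so subsets of prescribed sizes can be chosen in each of them
  independently; the set \<open>X\<close> holds positions whose signs are to be fixed separately.\<close>

lemma choose_in_blocks:
  assumes "\<And>t. t < r \<Longrightarrow> p t \<le> card (block t - X)"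
  shows "\<exists>Q. Q \<inter> X = {} \<and> (\<forall>t<r. card (Q \<inter> block t) = p t)"
proof -
  have "\<exists>R. R \<subseteq> block t - X \<and> card R = p t" if "t < r" for t
    using obtain_subset_with_card_n[OF assms[OF that]] by metis
  then obtain R where R: "\<And>t. t < r \<Longrightarrow> R t \<subseteq> block t - X" "\<And>t. t < r \<Longrightarrow> card (R t) = p t"
    by metis
  have "(\<Union>t<r. R t) \<inter> block t = R t" if "t < r" for t
    using R(1) that by force
  then have "card ((\<Union>t<r. R t) \<inter> block t) = p t" if "t < r" for t
    using R(2) that by simp
  moreover have "(\<Union>t<r. R t) \<inter> X = {}" using R(1) by blast
  ultimately show ?thesis by blast
qed

text \<open>In block \<open>t\<close>, put a plus sign on \<open>k t + c t\<close> of the \<open>2 * k t\<close> positions. Since the blocks have even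
  size, exactly the even block sums occur; this is why \<open>2 * c\<close> is reached rather than \<open>c\<close>, which is
  harmless for spans.\<close>

lemma sign_vec_with_block_sums:
  assumes "\<And>t. t < r \<Longrightarrow> \<bar>c t\<bar> \<le> int (k t)"
  obtains P where "summation_mat *\<^sub>v sign_vec P = vec r (\<lambda>t. 2 * of_int (c t))"
proof -
  have "nat (int (k t) + c t) \<le> card (block t - {})" if "t < r" for t
    using assms[OF that] card_block[OF that] by auto
  then obtain P where P: "\<And>t. t < r \<Longrightarrow> card (P \<inter> block t) = nat (int (k t) + c t)"
    using choose_in_blocks[of "\<lambda>t. nat (int (k t) + c t)" "{}"] by blast
  have "real (card (P \<inter> block t)) - real (k t) = of_int (c t)" if "t < r" for t
    using assms[OF that] P[OF that] by simp
  then have "summation_mat *\<^sub>v sign_vec P = vec r (\<lambda>t. 2 * of_int (c t))"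
    by (intro eq_vecI) (auto simp: block_sum_sign_vec simp del: index_mult_mat_vec)
  then show ?thesis by (rule that)
qed

lemma summation_mat_surj:
  assumes "w \<in> carrier_vec r"
  shows "\<exists>y\<in>carrier_vec N. summation_mat *\<^sub>v y = w"
proof
  define y where "y = vec N (\<lambda>j. w $ b j / (2 * real (k (b j))))"
  show "y \<in> carrier_vec N" by (simp add: y_def)
  have "(summation_mat *\<^sub>v y) $ t = w $ t" if "t < r" for t
  proof -
    have "(summation_mat *\<^sub>v y) $ t = (\<Sum>j\<in>block t. w $ t / (2 * real (k t)))"
      using that by (subst block_sum) (auto simp: y_def intro!: sum.cong)
    then show ?thesis using card_block[OF that] size_pos[OF that] by simp
  qed
  then show "summation_mat *\<^sub>v y = w" using assms by (intro eq_vecI) auto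
qed

lemma block_representative:
  shows "\<exists>s. \<forall>t<r. s t < N \<and> b (s t) = t"
proof -
  have "block t \<noteq> {}" if "t < r" for t
    using card_block[OF that] size_pos[OF that] by (metis card.empty mult_is_0 not_gr0 zero_neq_numeral)
  then have "\<forall>t\<in>{..<r}. \<exists>j. j < N \<and> b j = t" by blast
  then show ?thesis by (metis lessThan_iff)
qed

text \<open>Choose a sign vector with all block sums zero that is \<open>1\<close> at \<open>i\<close> and \<open>-1\<close> at \<open>j\<close>. Exchanging
  these two signs keeps the block sums, and the difference of the two vectors is
  \<open>2 * (unit_vec N i - unit_vec N j)\<close>.\<close>

lemma unit_vec_diff_in_subspace:
  assumes W: "submodule class_ring W (module_vec TYPE(real) N)"
    and bal: "mat_kernel summation_mat \<inter> sign_vecs N \<subseteq> W"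
    and ij: "i < N" "j < N" "b i = b j"
  shows "unit_vec N i - unit_vec N j \<in> W"
proof -
  interpret vec_space "TYPE(real)" N .
  note WD = submoduleD_vec[OF W]
  show ?thesis
  proof (cases "i = j")
    case True
    then have "unit_vec N i - unit_vec N j = (0\<^sub>v N :: real vec)" by (intro eq_vecI) auto
    then show ?thesis using WD(2) by simp
  next
    case False
    (* The number of plus signs outside {i, j}: one plus sign of the common block of i and j is
       reserved for i or for j. *)
    define p where "p t = (if t = b i then k t - 1 else k t)" for t
    have "p t \<le> card (block t - {i, j})" if t: "t < r" for t
    proof (cases "t = b i")
      case True
      have "card (block t - {i, j}) = card (block t) - card {i, j}"
        using ij True by (intro card_Diff_subset) auto
      then show ?thesis using False True card_block[OF t] size_pos[OF t] by (simp add: p_def)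
    next
      case False
      then have "block t - {i, j} = block t" using ij by auto
      then show ?thesis using False card_block[OF t] by (simp add: p_def)
    qed
    then obtain Q where Q: "Q \<inter> {i, j} = {}" "\<And>t. t < r \<Longrightarrow> card (Q \<inter> block t) = p t"
      using choose_in_blocks[of p "{i, j}"] by blast
    have bi: "b i < r" by (rule label_less[OF ij(1)])
    have kern: "sign_vec (insert h Q) \<in> W" if h: "h \<in> {i, j}" for h
    proof -
      have hb: "b h = b i" "h < N" "h \<notin> Q" using h ij Q(1) by auto
      have "card (insert h Q \<inter> block t) = k t" if t: "t < r" for t
      proof (cases "t = b i")
        case True
        then have "insert h Q \<inter> block t = insert h (Q \<inter> block t)" using hb by auto
        moreover have "finite (Q \<inter> block t)" by simp
        ultimately have "card (insert h Q \<inter> block t) = Suc (p t)" using hb Q(2)[OF t] by simp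
        then show ?thesis using True size_pos[OF t] by (simp add: p_def)
      next
        case False
        then have "insert h Q \<inter> block t = Q \<inter> block t" using hb by auto
        then show ?thesis using False Q(2)[OF t] by (simp add: p_def)
      qed
      then have "summation_mat *\<^sub>v sign_vec (insert h Q) = 0\<^sub>v r"
        by (intro eq_vecI) (auto simp: block_sum_sign_vec simp del: index_mult_mat_vec)
      then show ?thesis
        using bal sign_vec_in_sign_vecs[of "insert h Q"] by (auto simp: mat_kernel_def)
    qed
    have "unit_vec N i - unit_vec N j
        = (1 / 2) \<cdot>\<^sub>v (sign_vec (insert i Q) - sign_vec (insert j Q))"
      using ij False Q(1) by (intro eq_vecI) (auto simp: sign_vec_def)
    also have "\<dots> \<in> W" using kern by (intro WD(4) submodule_diff_vec[OF W]) auto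
    finally show ?thesis .
  qed
qed

text \<open>A vector with zero block sums is a combination of differences of unit vectors in the same
  block: subtracting from each \<open>unit_vec N j\<close> the unit vector at a fixed representative \<open>s (b j)\<close> changes
  \<open>\<Sum>j. y $ j * unit_vec N j\<close> by the block sums placed at the representatives, hence not at all.\<close>

lemma summation_kernel_subset:
  assumes W: "submodule class_ring W (module_vec TYPE(real) N)"
    and bal: "mat_kernel summation_mat \<inter> sign_vecs N \<subseteq> W"
    and y: "y \<in> mat_kernel summation_mat"
  shows "y \<in> W"
proof -
  interpret vec_space "TYPE(real)" N .
  obtain s where s: "\<And>t. t < r \<Longrightarrow> s t < N \<and> b (s t) = t" using block_representative by blast
  have yc: "y \<in> carrier_vec N" and y0: "summation_mat *\<^sub>v y = 0\<^sub>v r"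
    using mat_kernelD[OF summation_mat_carrier y] by auto
  let ?f = "\<lambda>j. unit_vec N j - unit_vec N (s (b j)) :: real vec"
  have "vec N (\<lambda>i. \<Sum>j<N. y $ j * ?f j $ i) \<in> W"
    using s label_less by (intro submodule_sum_vec[OF W] unit_vec_diff_in_subspace[OF W bal]) auto
  also have "vec N (\<lambda>i. \<Sum>j<N. y $ j * ?f j $ i) = y"
  proof (intro eq_vecI)
    fix i assume "i < dim_vec y"
    then have i: "i < N" using yc by simp
    have "(\<Sum>j<N. y $ j * (if i = s (b j) then 1 else 0)) = 0"
    proof (cases "i = s (b i)")
      case True
      have eq: "i = s (b j) \<longleftrightarrow> b j = b i" if "j < N" for j
        using True s label_less i that by metis
      have "(\<Sum>j<N. y $ j * (if i = s (b j) then 1 else 0)) = (\<Sum>j<N. if b j = b i then y $ j else 0)"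
        using eq by (intro sum.cong) auto
      also have "\<dots> = (\<Sum>j\<in>{..<N} \<inter> {j. b j = b i}. y $ j)"
        by (simp add: sum.inter_restrict)
      also have "{..<N} \<inter> {j. b j = b i} = block (b i)" by auto
      also have "(\<Sum>j\<in>block (b i). y $ j) = 0"
        using block_sum[OF yc label_less[OF i]] label_less[OF i] y0 by simp
      finally show ?thesis .
    next
      case False
      then have "i \<noteq> s (b j)" if "j < N" for j using s[OF label_less[OF that]] by metis
      then show ?thesis by (intro sum.neutral) auto
    qed
    moreover have "(\<Sum>j<N. y $ j * (if i = j then 1 else 0)) = y $ i"
      using i by (simp add: if_distrib[of "\<lambda>x. _ * x"] cong: if_cong)
    moreover have "y $ j * ?f j $ i
      = y $ j * (if i = j then 1 else 0) - y $ j * (if i = s (b j) then 1 else 0)" if "j < N" for j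
      using i s[OF label_less[OF that]] that by (simp add: right_diff_distrib)
    ultimately show "vec N (\<lambda>i. \<Sum>j<N. y $ j * ?f j $ i) $ i = y $ i"
      using i by (simp add: sum_subtractf)
  qed (use yc in simp)
  finally show ?thesis .
qed

text \<open>Modulo the kernel of the summation map, which already lies in the span by
  \<open>summation_kernel_subset\<close>, it suffices that the block sums of the span exhaust \<open>L\<close>. They form a
  subspace, and it contains \<open>2 \<cdot>\<^sub>v g\<close> for each generator \<open>g\<close> because \<open>g\<close> is integral with entries
  bounded by half the block sizes.\<close>

lemma span_sign_vecs_eq_vimage:
  assumes span_G: "L = LinearCombinations.module.span class_ring (module_vec TYPE(real) r) G"
    and G: "G \<subseteq> int_vecs r" and small: "\<And>g t. g \<in> G \<Longrightarrow> t < r \<Longrightarrow> \<bar>g $ t\<bar> \<le> real (k t)"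
  shows "LinearCombinations.module.span class_ring (module_vec TYPE(real) N)
           {y \<in> sign_vecs N. summation_mat *\<^sub>v y \<in> L}
       = {y \<in> carrier_vec N. summation_mat *\<^sub>v y \<in> L}" (is "?S = ?U")
proof -
  interpret N: vec_space "TYPE(real)" N .
  interpret r: vec_space "TYPE(real)" r .
  let ?A = "summation_mat" and ?X = "{y \<in> sign_vecs N. summation_mat *\<^sub>v y \<in> L}"
  have GC: "G \<subseteq> carrier_vec r" using G by (auto simp: int_vecs_def)
  have Lsub: "submodule class_ring L r.V" unfolding span_G using GC by (intro r.span_is_submodule) auto
  note LD = r.submoduleD_vec[OF Lsub]
  have U: "submodule class_ring ?U N.V"
    by (rule dim_vimage_mult_mat_vec(2)[OF summation_mat_carrier summation_mat_surj Lsub])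
  have XC: "?X \<subseteq> carrier_vec N" by (auto simp: sign_vecs_def)
  have S: "submodule class_ring ?S N.V" using XC by (intro N.span_is_submodule) auto
  note SD = N.submoduleD_vec[OF S]
  have XS: "?X \<subseteq> ?S" using N.in_own_span[of ?X] XC by auto
  have "?S \<subseteq> ?U" by (rule N.span_is_subset[OF _ U]) (use XC in auto)
  moreover have "?U \<subseteq> ?S"
  proof
    define T where "T = {w. \<exists>y\<in>?S. ?A *\<^sub>v y = w}"
    have "submodule class_ring T r.V"
    proof (rule r.submoduleI_vec)
      show "T \<subseteq> carrier_vec r"
        unfolding T_def using SD(1) mult_mat_vec_carrier[OF summation_mat_carrier] by blast
      have "?A *\<^sub>v 0\<^sub>v N = 0\<^sub>v r" by (intro eq_vecI) auto
      then show "0\<^sub>v r \<in> T" unfolding T_def using SD(2) by blast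
    next
      fix v w assume "v \<in> T" "w \<in> T"
      then obtain y z where "y \<in> ?S" "?A *\<^sub>v y = v" "z \<in> ?S" "?A *\<^sub>v z = w" 
        unfolding T_def by blast
      moreover then have "?A *\<^sub>v (y + z) = v + w"
        using SD(1) mult_add_distrib_mat_vec[OF summation_mat_carrier] by blast
      ultimately show "v + w \<in> T" unfolding T_def using SD(3) by blast
    next
      fix c v assume "v \<in> T"
      then obtain y where "y \<in> ?S" "?A *\<^sub>v y = v" 
        unfolding T_def by blast
      moreover then have "?A *\<^sub>v (c \<cdot>\<^sub>v y) = c \<cdot>\<^sub>v v"
        using SD(1) mult_mat_vec[OF summation_mat_carrier] by blast
      ultimately show "c \<cdot>\<^sub>v v \<in> T" unfolding T_def using SD(4) by blast
    qed
    note T = this r.submoduleD_vec[OF this]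
    have "G \<subseteq> T"
    proof
      fix g assume g: "g \<in> G"
      define c where "c t = \<lfloor>g $ t\<rfloor>" for t
      have gc: "g $ t = of_int (c t)" if "t < r" for t
        using g G that by (auto simp: int_vecs_def c_def elim: Ints_cases)
      have "\<bar>c t\<bar> \<le> int (k t)" if "t < r" for t
        using small[OF g that] gc[OF that] by linarith
      then obtain P where "?A *\<^sub>v sign_vec P = vec r (\<lambda>t. 2 * of_int (c t))"
        using sign_vec_with_block_sums[of c] by metis
      also have "\<dots> = 2 \<cdot>\<^sub>v g" using g GC gc by (intro eq_vecI) auto
      finally have P: "?A *\<^sub>v sign_vec P = 2 \<cdot>\<^sub>v g" .
      have "g \<in> L" unfolding span_G using r.in_own_span[of G] GC g by auto
      then have "sign_vec P \<in> ?S" using XS P LD(4) sign_vec_in_sign_vecs by auto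
      then have "2 \<cdot>\<^sub>v g \<in> T" unfolding T_def using P by auto
      then have "(1 / 2) \<cdot>\<^sub>v (2 \<cdot>\<^sub>v g) \<in> T" by (rule T(5))
      then show "g \<in> T" by (simp add: smult_smult_assoc)
    qed
    then have "L \<subseteq> T" unfolding span_G by (rule r.span_is_subset[OF _ T(1)])
    fix y assume y: "y \<in> ?U"
    then obtain z where z: "z \<in> ?S" "?A *\<^sub>v z = ?A *\<^sub>v y" using \<open>L \<subseteq> T\<close> unfolding T_def by blast
    have zc: "z \<in> carrier_vec N" using z SD(1) by auto
    have "?A *\<^sub>v (y - z) = 0\<^sub>v r"
      using mult_minus_distrib_mat_vec[OF summation_mat_carrier, of y z] y zc z by auto
    then have "y - z \<in> mat_kernel ?A" using y zc by (intro mat_kernelI[OF summation_mat_carrier]) auto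
    moreover have "mat_kernel ?A \<inter> sign_vecs N \<subseteq> ?S"
      using XS LD(2) by (auto simp: mat_kernel_def)
    ultimately have "y - z \<in> ?S" by (intro summation_kernel_subset[OF S])
    then have "(y - z) + z \<in> ?S" using z(1) by (rule SD(3))
    moreover have "(y - z) + z = y" using y zc by (intro eq_vecI) auto
    ultimately show "y \<in> ?S" by simp
  qed
  ultimately show ?thesis by blast
qed

end

section \<open>Kernels of replicated matrices\<close>

definition column_labels :: "nat \<Rightarrow> nat vec \<Rightarrow> nat list" where
  "column_labels r m = concat (map (\<lambda>t. replicate (m $ t) t) [0..<r])"

lemma column_labels_less: "j < length (column_labels r m) \<Longrightarrow> column_labels r m ! j < r"
  using nth_mem[of j "column_labels r m"] by (auto simp: column_labels_def)

lemma card_column_label: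
  assumes "t < r"
  shows "card {j. j < length (column_labels r m) \<and> column_labels r m ! j = t} = m $ t"
proof -
  have "length (filter (\<lambda>s. s = t) (column_labels q m)) = (if t < q then m $ t else 0)" for q
    by (induction q) (use assms in \<open>auto simp: column_labels_def less_Suc_eq\<close>)
  then show ?thesis using assms by (simp add: length_filter_conv_card)
qed

text \<open>Multiplying by the 0/1 incidence matrix of labels and positions copies column \<open>s\<close> of \<open>B\<close>
  to every position labelled \<open>s\<close>.\<close>

lemma replicate_cols_eq_mult:
  fixes B :: "real mat" and m :: "nat vec"
  assumes B: "B \<in> carrier_mat d r"
  defines "bs \<equiv> column_labels r m"
  shows "replicate_cols B m
       = B * mat r (length bs) (\<lambda>(t, j). if bs ! j = t then 1 else 0)"
proof -
  have R: "replicate_cols B m = mat_of_cols d (map (col B) bs)"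
    using B by (simp add: replicate_cols_def bs_def column_labels_def map_concat o_def map_replicate)
  have "(\<Sum>s\<in>{0..<r}. B $$ (i, s) * (if bs ! j = s then 1 else 0)) = B $$ (i, bs ! j)"
    if "j < length bs" for i j
    using column_labels_less[of j r m] that
    by (simp add: bs_def if_distrib[of "\<lambda>x. _ * x"] cong: if_cong)
  then show ?thesis
    unfolding R using B column_labels_less[of _ r m]
    by (intro eq_matI) (auto simp: mat_of_cols_def scalar_prod_def bs_def)
qed

lemma even_blocks_column_labels:
  assumes k: "k \<in> carrier_vec r" and pos: "\<And>t. t < r \<Longrightarrow> 0 < k $ t"
  shows "even_blocks (length (column_labels r (2 \<cdot>\<^sub>v k))) r
           (\<lambda>j. column_labels r (2 \<cdot>\<^sub>v k) ! j) (\<lambda>t. k $ t)"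
  by (rule even_blocks.intro) (use k pos in \<open>auto simp: column_labels_less card_column_label\<close>)

lemma kernel_dim_as_dim:
  "kernel_dim A = vectorspace.dim class_ring (module_vec TYPE('a) (dim_col A)\<lparr>carrier := mat_kernel A\<rparr>)"
  for A :: "'a :: field mat"
  by (simp add: kernel_dim_def)

lemma mat_kernel_submodule:
  fixes A :: "'a :: field mat"
  assumes "A \<in> carrier_mat d r"
  shows "submodule class_ring (mat_kernel A) (module_vec TYPE('a) r)"
proof -
  have "A *\<^sub>v 0\<^sub>v r = 0\<^sub>v d" using assms by auto
  then show ?thesis
    using assms unfolding mat_kernel[OF assms]
    by (intro vec_space.submoduleI_vec)
      (auto simp: mult_add_distrib_mat_vec[OF assms] mult_mat_vec[OF assms])
qed

text \<open>Both dimensions on the left are dimensions of preimages under the summation map: of the kernel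
  of \<open>B\<close>, and of the span \<open>L\<close> of its integer points. For the second one, note that the block sums of a
  sign vector are integers, so that a sign vector lies in the kernel of \<open>B * summation_mat\<close> if and only
  if its block sums lie in \<open>L\<close>.\<close>

lemma (in even_blocks) kernel_dim_minus_sigma:
  assumes B: "B \<in> carrier_mat d r"
    and G: "G \<subseteq> mat_kernel B \<inter> int_vecs r"
    and span_G: "LinearCombinations.module.span class_ring (module_vec TYPE(real) r) G
      = LinearCombinations.module.span class_ring (module_vec TYPE(real) r) (mat_kernel B \<inter> int_vecs r)"
    and small: "\<And>g t. g \<in> G \<Longrightarrow> t < r \<Longrightarrow> \<bar>g $ t\<bar> \<le> real (k t)"
  shows "int (kernel_dim (B * summation_mat)) - int (sigma (B * summation_mat))
       = int (kernel_dim B) - int (ell_int B)"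
proof -
  interpret N: vec_space "TYPE(real)" N .
  interpret r: vec_space "TYPE(real)" r .
  let ?A = summation_mat and ?I = "mat_kernel B \<inter> int_vecs r"
  define L where "L = r.span ?I"
  have K: "submodule class_ring (mat_kernel B) r.V" by (rule mat_kernel_submodule[OF B])
  have IC: "?I \<subseteq> carrier_vec r" by (auto simp: int_vecs_def)
  have L: "submodule class_ring L r.V" unfolding L_def using IC by (intro r.span_is_submodule) auto
  have LK: "L \<subseteq> mat_kernel B" unfolding L_def by (rule r.span_is_subset[OF _ K]) auto
  have IL: "?I \<subseteq> L" unfolding L_def using r.in_own_span[of ?I] IC by auto
  have BA: "B * ?A \<in> carrier_mat d N" using B by auto
  have ker_BA: "mat_kernel (B * ?A) = {y \<in> carrier_vec N. ?A *\<^sub>v y \<in> mat_kernel B}"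
    unfolding mat_kernel[OF BA] mat_kernel[OF B]
    using assoc_mult_mat_vec[OF B summation_mat_carrier] 
      mult_mat_vec_carrier[OF summation_mat_carrier] by auto
  have "?A *\<^sub>v y \<in> int_vecs r" if "y \<in> sign_vecs N" for y
  proof -
    have "y $ j \<in> \<int>" if "j < N" for j
      using \<open>y \<in> sign_vecs N\<close> that unfolding sign_vecs_def by fastforce
    moreover have "y \<in> carrier_vec N" using that by (simp add: sign_vecs_def)
    moreover have "?A *\<^sub>v y \<in> carrier_vec r" by (rule mult_mat_vec_carrier[OF summation_mat_carrier calculation(2)])
    ultimately show ?thesis
      by (auto simp: int_vecs_def block_sum simp del: index_mult_mat_vec intro!: Ints_sum)
  qed
  then have signs: "mat_kernel (B * ?A) \<inter> sign_vecs N = {y \<in> sign_vecs N. ?A *\<^sub>v y \<in> L}"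
    using IL LK unfolding ker_BA by (auto simp: sign_vecs_def)
  have "N.span {y \<in> sign_vecs N. ?A *\<^sub>v y \<in> L} = {y \<in> carrier_vec N. ?A *\<^sub>v y \<in> L}"
    using G span_G
    by (intro span_sign_vecs_eq_vimage[of L G] small) (auto simp: L_def)
  then have "sigma (B * ?A)
      = vectorspace.dim class_ring (N.V\<lparr>carrier := {y \<in> carrier_vec N. ?A *\<^sub>v y \<in> L}\<rparr>)"
    by (simp add: sigma_def span_dim_def signs)
  also have "\<dots> = vectorspace.dim class_ring (r.V\<lparr>carrier := L\<rparr>) + kernel_dim ?A"
    by (rule dim_vimage_mult_mat_vec(1)[OF summation_mat_carrier summation_mat_surj L])
  also have "vectorspace.dim class_ring (r.V\<lparr>carrier := L\<rparr>) = ell_int B"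
    using B by (simp add: ell_int_def span_dim_def L_def)
  finally have sigma: "sigma (B * ?A) = ell_int B + kernel_dim ?A" .
  have "kernel_dim (B * ?A) = vectorspace.dim class_ring
      (N.V\<lparr>carrier := {y \<in> carrier_vec N. ?A *\<^sub>v y \<in> mat_kernel B}\<rparr>)"
    by (simp add: kernel_dim_as_dim ker_BA)
  also have "\<dots> = vectorspace.dim class_ring (r.V\<lparr>carrier := mat_kernel B\<rparr>) + kernel_dim ?A"
    by (rule dim_vimage_mult_mat_vec(1)[OF summation_mat_carrier summation_mat_surj K])
  also have "vectorspace.dim class_ring (r.V\<lparr>carrier := mat_kernel B\<rparr>) = kernel_dim B"
    using B by (simp add: kernel_dim_as_dim)
  finally show ?thesis using sigma by simp
qed

text \<open>The threshold bounds all entries of a finite set of integer kernel vectors of \<open>B\<close> that spans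
  all of them.\<close>

lemma replication_threshold:
  fixes B :: "real mat"
  assumes B: "B \<in> carrier_mat d r"
  shows "\<exists>\<kappa>0 > 0. \<forall>k \<in> carrier_vec r. (\<forall>t<r. \<kappa>0 \<le> k $ t) \<longrightarrow>
      int (kernel_dim (replicate_cols B (2 \<cdot>\<^sub>v k))) - int (sigma (replicate_cols B (2 \<cdot>\<^sub>v k)))
        = int (kernel_dim B) - int (ell_int B)"
proof -
  interpret r: vec_space "TYPE(real)" r .
  have "mat_kernel B \<inter> int_vecs r \<subseteq> carrier_vec r" by (auto simp: int_vecs_def)
  then obtain G where G: "G \<subseteq> mat_kernel B \<inter> int_vecs r" "finite G"
      "r.span G = r.span (mat_kernel B \<inter> int_vecs r)"
    using r.finite_spanning_subset by metis
  (* Unlike a maximum, the sum of all absolute values needs no case distinction for empty G or r = 0. *)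
  define \<kappa>0 where "\<kappa>0 = Suc (nat \<lceil>\<Sum>g\<in>G. \<Sum>t<r. \<bar>g $ t\<bar>\<rceil>)"
  have bound: "\<bar>g $ t\<bar> \<le> real \<kappa>0" if "g \<in> G" "t < r" for g t
  proof -
    have "\<bar>g $ t\<bar> \<le> (\<Sum>t<r. \<bar>g $ t\<bar>)"
      using that by (intro member_le_sum) auto
    also have "\<dots> \<le> (\<Sum>g\<in>G. \<Sum>t<r. \<bar>g $ t\<bar>)"
      using that G by (intro member_le_sum[of g G "\<lambda>g. \<Sum>t<r. \<bar>g $ t\<bar>"]) (auto intro: sum_nonneg)
    finally show ?thesis unfolding \<kappa>0_def by linarith
  qed
  have "int (kernel_dim (replicate_cols B (2 \<cdot>\<^sub>v k))) - int (sigma (replicate_cols B (2 \<cdot>\<^sub>v k)))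
      = int (kernel_dim B) - int (ell_int B)"
    if k: "k \<in> carrier_vec r" and large: "\<And>t. t < r \<Longrightarrow> \<kappa>0 \<le> k $ t" for k
  proof -
    have "0 < k $ t" if "t < r" for t using large[OF that] by (simp add: \<kappa>0_def)
    then interpret even_blocks "length (column_labels r (2 \<cdot>\<^sub>v k))" r
        "\<lambda>j. column_labels r (2 \<cdot>\<^sub>v k) ! j" "\<lambda>t. k $ t"
      by (rule even_blocks_column_labels[OF k])
    have "\<bar>g $ t\<bar> \<le> real (k $ t)" if "g \<in> G" "t < r" for g t
      using bound[OF that] large[OF that(2)] by linarith
    from kernel_dim_minus_sigma[OF B G(1,3) this] show ?thesis
      by (simp add: replicate_cols_eq_mult[OF B] summation_mat_def)
  qed
  then show ?thesis by (intro exI[of _ \<kappa>0]) (auto simp: \<kappa>0_def)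
qed

theorem corollary3p10:
  fixes B :: "real mat" and d r :: nat
  assumes "B \<in> carrier_mat d r"
  shows "(\<exists>k0 :: nat vec. k0 \<in> carrier_vec r \<and> (\<forall>t<r. 0 < k0 $ t) \<and>
            (\<forall>k :: nat vec. k \<in> carrier_vec r \<and> (\<forall>t<r. 0 < k $ t) \<and> k0 \<le> k \<longrightarrow>
               int (kernel_dim (replicate_cols B (2 \<cdot>\<^sub>v k))) - int (sigma (replicate_cols B (2 \<cdot>\<^sub>v k)))
                 = int (kernel_dim B) - int (ell_int B)))
       \<and> (\<exists>\<kappa>0 :: nat. 0 < \<kappa>0 \<and>
            (\<forall>\<kappa>\<ge>\<kappa>0.
               int (kernel_dim (replicate_cols B (2 \<cdot>\<^sub>v vec r (\<lambda>t. \<kappa>))))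
                 - int (sigma (replicate_cols B (2 \<cdot>\<^sub>v vec r (\<lambda>t. \<kappa>))))
                 = int (kernel_dim B) - int (ell_int B)))"
proof -
  define P where "P k \<longleftrightarrow>
      int (kernel_dim (replicate_cols B (2 \<cdot>\<^sub>v k))) - int (sigma (replicate_cols B (2 \<cdot>\<^sub>v k)))
        = int (kernel_dim B) - int (ell_int B)" for k
  have "\<exists>\<kappa>0 > 0. \<forall>k \<in> carrier_vec r. (\<forall>t<r. \<kappa>0 \<le> k $ t) \<longrightarrow> P k"
    unfolding P_def by (rule replication_threshold[OF assms])
  then obtain \<kappa>0 where pos: "0 < \<kappa>0"
    and thr: "\<And>k. k \<in> carrier_vec r \<Longrightarrow> \<forall>t<r. \<kappa>0 \<le> k $ t \<Longrightarrow> P k"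
    by blast
  have "P k" if "k \<in> carrier_vec r" "vec r (\<lambda>_. \<kappa>0) \<le> k" for k
    using that by (intro thr) (auto simp: less_eq_vec_def)
  then have "\<exists>k0. k0 \<in> carrier_vec r \<and> (\<forall>t<r. 0 < k0 $ t) \<and>
      (\<forall>k. k \<in> carrier_vec r \<and> (\<forall>t<r. 0 < k $ t) \<and> k0 \<le> k \<longrightarrow> P k)"
    using pos by (intro exI[of _ "vec r (\<lambda>_. \<kappa>0)"]) simp
  moreover have "\<exists>\<kappa>0. 0 < \<kappa>0 \<and> (\<forall>\<kappa>\<ge>\<kappa>0. P (vec r (\<lambda>t. \<kappa>)))"
    using pos thr by (intro exI[of _ \<kappa>0]) simp
  ultimately show ?thesis unfolding P_def by (rule conjI)
qed

end
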